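(* Let $T$ be a finite metric tree of length $L=|T|>0$, and let $\mathbf s=(s_1,\dots,s_m)\in\mathcal C(T)$ satisfy $0\le s_i\le L$ for every $i$. After reordering the radii, some subtuple of $\mathbf s$ belongs to $\mathcal C(T,0)$.
   Context: A finite metric tree is the metric realization of a finite combinatorial tree whose edges have positive lengths. $|T|$ is the total edge length, $d_T$ the path metric, and $B_T(v,s)=\{x\in T: d_T(x,v)\le s\}$. $\mathcal C(T)$ is the set of covers of $T$: tuples $(r_1,\dots,r_m)\in\mathbb R_{\ge0}^m$, $m\ge1$, for which there are centers $v_1,\dots,v_m\in T$ with $T\subseteq\bigcup_{i=1}^m B_T(v_i,r_i)$. $\mathcal C(T,0)$ is the set of covers with $\sum_i r_i\le|T|$. (The centers realizing the subtuple as a cover need not be those realizing $\mathbf s$.) *)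

theory Defs
  imports Complex_Main "HOL-Library.Multiset" "HOL-Library.Sublist"
begin

(* The notion of tree in Graph_Theory only excludes directed cycles, so undirected
   combinatorial trees are set up here. *)

record 'v weighted_graph =
  verts :: "'v set"
  edges :: "'v set set"
  len :: "'v set \<Rightarrow> real"

definition finite_simple_graph :: "('v, 'z) weighted_graph_scheme \<Rightarrow> bool" where
  "finite_simple_graph T \<longleftrightarrow>
     finite (verts T) \<and> (\<forall>e\<in>edges T. e \<subseteq> verts T \<and> card e = 2)"

definition connected_graph :: "('v, 'z) weighted_graph_scheme \<Rightarrow> bool" where
  "connected_graph T \<longleftrightarrow>
     verts T \<noteq> {} \<and> (\<forall>u\<in>verts T. \<forall>v\<in>verts T. (u, v) \<in> {(x, y). {x, y} \<in> edges T}\<^sup>*)"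

definition graph_cycle :: "('v, 'z) weighted_graph_scheme \<Rightarrow> 'v list \<Rightarrow> bool" where
  "graph_cycle T c \<longleftrightarrow> 3 \<le> length c \<and> distinct c \<and>
     (\<forall>i<length c. {c ! i, c ! (Suc i mod length c)} \<in> edges T)"

definition finite_metric_tree :: "('v, 'z) weighted_graph_scheme \<Rightarrow> bool" where
  "finite_metric_tree T \<longleftrightarrow>
     finite_simple_graph T \<and> connected_graph T \<and> (\<nexists>c. graph_cycle T c) \<and>
     (\<forall>e\<in>edges T. 0 < len T e)"

definition total_length :: "('v, 'z) weighted_graph_scheme \<Rightarrow> real" where
  "total_length T = (\<Sum>e\<in>edges T. len T e)"

(* Points of the metric realization, in barycentric coordinates: the vertex v is the
   indicator function of v, and the point of the edge {a, b} at distance t from a has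
   coordinates 1 - t / len {a, b} at a and t / len {a, b} at b. *)
definition points :: "('v, 'z) weighted_graph_scheme \<Rightarrow> ('v \<Rightarrow> real) set" where
  "points T = {p. (\<forall>v. 0 \<le> p v) \<and> (\<Sum>v\<in>verts T. p v) = 1 \<and>
     {v. p v \<noteq> 0} \<in> (\<lambda>v. {v}) ` verts T \<union> edges T}"

definition closed_edge :: "('v, 'z) weighted_graph_scheme \<Rightarrow> 'v set \<Rightarrow> ('v \<Rightarrow> real) set" where
  "closed_edge T e = {p \<in> points T. {v. p v \<noteq> 0} \<subseteq> e}"

(* Length of the segment between two points of one closed edge {a, b}. Both summands
   are equal because p a + p b = q a + q b = 1, hence the division by 2. *)
definition segment_length ::
    "('v, 'z) weighted_graph_scheme \<Rightarrow> 'v set \<Rightarrow> ('v \<Rightarrow> real) \<Rightarrow> ('v \<Rightarrow> real) \<Rightarrow> real" where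
  "segment_length T e p q = len T e * (\<Sum>v\<in>e. \<bar>p v - q v\<bar>) / 2"

(* path_of_length T p q c: some concatenation of finitely many segments, each inside a
   single closed edge, leads from p to q and has length c. *)
inductive path_of_length ::
    "('v, 'z) weighted_graph_scheme \<Rightarrow> ('v \<Rightarrow> real) \<Rightarrow> ('v \<Rightarrow> real) \<Rightarrow> real \<Rightarrow> bool"
  for T where
  trivial: "p \<in> points T \<Longrightarrow> path_of_length T p p 0"
| extend: "path_of_length T p q c \<Longrightarrow> e \<in> edges T \<Longrightarrow> q \<in> closed_edge T e \<Longrightarrow> r \<in> closed_edge T e
    \<Longrightarrow> path_of_length T p r (c + segment_length T e q r)"

definition path_dist ::
    "('v, 'z) weighted_graph_scheme \<Rightarrow> ('v \<Rightarrow> real) \<Rightarrow> ('v \<Rightarrow> real) \<Rightarrow> real" where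
  "path_dist T p q = Inf {c. path_of_length T p q c}"

definition tree_ball :: "('v, 'z) weighted_graph_scheme \<Rightarrow> ('v \<Rightarrow> real) \<Rightarrow> real \<Rightarrow> ('v \<Rightarrow> real) set" where
  "tree_ball T v s = {x \<in> points T. path_dist T x v \<le> s}"

definition covers :: "('v, 'z) weighted_graph_scheme \<Rightarrow> real list set" where
  "covers T = {r. r \<noteq> [] \<and> (\<forall>x\<in>set r. 0 \<le> x) \<and>
     (\<exists>v. length v = length r \<and> set v \<subseteq> points T \<and>
        points T \<subseteq> (\<Union>i<length r. tree_ball T (v ! i) (r ! i)))}"

definition covers0 :: "('v, 'z) weighted_graph_scheme \<Rightarrow> real list set" where
  "covers0 T = {r \<in> covers T. sum_list r \<le> total_length T}"

end

theory Submission
  imports Defs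
begin

text \<open>
  Write \<open>L\<close> for the total length. If \<open>\<Sum>i. s\<^sub>i \<le> L\<close>, the whole tuple works. Otherwise sort the radii
  in descending order and take the longest prefix \<open>r\<^sub>1 \<ge> \<dots> \<ge> r\<^sub>k\<close> with sum at most \<open>L\<close>. It is nonempty
  because every radius is at most \<open>L\<close>, and since the next radius overshoots \<open>L\<close> and is at most
  \<open>r\<^sub>k\<close>, we have \<open>L \<le> r\<^sub>1 + \<dots> + r\<^sub>k + r\<^sub>k\<close> (\<open>descending_prefix\<close>). Every tuple that is long in this sense
  covers the tree, by two observations.

  \<^item> A ball of radius \<open>r\<close> can be used up greedily (\<open>prune\<close>): go from a point farthest from the root
    towards the root by the distance \<open>r\<close>. The ball around the point \<open>v\<close> reached contains
    everything beyond \<open>v\<close> as seen from the root, and discarding that part shortens the tree by at least \<open>r\<close>.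
    Doing this with \<open>r\<^sub>1, \<dots>, r\<^sub>k\<^sub>-\<^sub>1\<close> leaves a tree of length at most \<open>2 r\<^sub>k\<close>, unless the tree has
    been exhausted before.
  \<^item> A tree of length at most \<open>2 r\<close> lies in one ball of radius \<open>r\<close> (\<open>covered_by_one_ball\<close>). Indeed,
    prune it once more: what remains contains the centre \<open>v\<close> and has length at most \<open>r\<close>, so it
    lies within \<open>r\<close> of \<open>v\<close> as well.

  Pruning cuts edges at interior points. It is therefore carried out on subsets of the realization
  that are built recursively from segments, so that pieces of edges are as good as edges
  (\<open>rooted_tree\<close>); that a finite metric tree is such a set is proved by adding one vertex at
  a time, where acyclicity ensures that each new vertex brings just one new edge. Covering needs
  only upper bounds on distances, so the relation ``joined by a path of length at most \<open>c\<close>'' can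
  replace the path metric throughout.
\<close>

section \<open>Covering rooted trees by balls\<close>

text \<open>Here \<open>dist_le x y c\<close> plays the role of \<open>d(x, y) \<le> c\<close>. For the tree it will say that some path of
  length at most \<open>c\<close> joins \<open>x\<close> and \<open>y\<close>, which makes symmetry and the triangle inequality a matter of
  reversing and concatenating paths, without infima.\<close>

locale upper_distance =
  fixes X :: "'a set" and dist_le :: "'a \<Rightarrow> 'a \<Rightarrow> real \<Rightarrow> bool"
  assumes dist_le_refl: "x \<in> X \<Longrightarrow> dist_le x x 0"
    and dist_le_sym: "dist_le x y c \<Longrightarrow> dist_le y x c"
    and dist_le_trans: "dist_le x y c \<Longrightarrow> dist_le y z d \<Longrightarrow> dist_le x z (c + d)"
    and dist_le_mono: "dist_le x y c \<Longrightarrow> c \<le> d \<Longrightarrow> dist_le x y d"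
begin

definition segment :: "(real \<Rightarrow> 'a) \<Rightarrow> real \<Rightarrow> bool" where
  "segment g t \<longleftrightarrow> 0 \<le> t \<and> g ` {0..t} \<subseteq> X \<and>
     (\<forall>u\<in>{0..t}. \<forall>v\<in>{0..t}. dist_le (g u) (g v) \<bar>u - v\<bar>)"

lemma segmentD:
  "segment g t \<Longrightarrow> u \<in> {0..t} \<Longrightarrow> v \<in> {0..t} \<Longrightarrow> dist_le (g u) (g v) \<bar>u - v\<bar>"
  unfolding segment_def by blast

text \<open>\<open>rooted_tree p A a\<close>: the set \<open>A\<close> is a tree of total length \<open>a\<close> hanging from the root \<open>p\<close>. A general
  rooted tree arises by gluing trees at a common root and by lengthening the stem of a tree.
  The pieces glued together may overlap in \<open>X\<close>; then \<open>a\<close> overestimates the length of the union,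
  which does no harm because distances inside \<open>A\<close> are bounded only from above.\<close>

inductive rooted_tree :: "'a \<Rightarrow> 'a set \<Rightarrow> real \<Rightarrow> bool" where
  point: "p \<in> X \<Longrightarrow> rooted_tree p {p} 0"
| join: "rooted_tree p A a \<Longrightarrow> rooted_tree p B b \<Longrightarrow> rooted_tree p (A \<union> B) (a + b)"
| stem: "segment g t \<Longrightarrow> rooted_tree (g t) A a \<Longrightarrow> rooted_tree (g 0) (g ` {0..t} \<union> A) (t + a)"

lemma rooted_tree_basics:
  "rooted_tree p A a \<Longrightarrow> p \<in> A \<and> A \<subseteq> X \<and> 0 \<le> a"
  by (induction rule: rooted_tree.induct) (auto simp: segment_def)

lemma segment_initial: "segment g t \<Longrightarrow> u \<in> {0..t} \<Longrightarrow> segment g u"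
  by (auto simp: segment_def)

lemma segment_final:
  assumes "segment g t" "u \<in> {0..t}"
  shows "segment (\<lambda>w. g (u + w)) (t - u)"
  unfolding segment_def
proof (intro conjI ballI)
  fix v w assume "v \<in> {0..t - u}" "w \<in> {0..t - u}"
  then have "u + v \<in> {0..t}" "u + w \<in> {0..t}" using assms(2) by auto
  then have "dist_le (g (u + v)) (g (u + w)) \<bar>(u + v) - (u + w)\<bar>"
    by (rule segmentD[OF assms(1)])
  then show "dist_le (g (u + v)) (g (u + w)) \<bar>v - w\<bar>" by simp
qed (use assms in \<open>auto simp: segment_def\<close>)

lemma stem_only:
  assumes "segment g t"
  shows "rooted_tree (g 0) (g ` {0..t}) t"
proof -
  have t: "t \<in> {0..t}" using assms by (auto simp: segment_def)
  then have "rooted_tree (g t) {g t} 0" using assms by (intro point) (auto simp: segment_def)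
  moreover have "g ` {0..t} \<union> {g t} = g ` {0..t}" using t by blast
  ultimately show ?thesis using stem[OF assms] by fastforce
qed

text \<open>A tree can be glued to any point of another one, not only to its root: if the point lies on a
  stem, the stem is split there.\<close>

lemma graft:
  assumes "rooted_tree p A a" "rooted_tree q B b" "q \<in> A"
  shows "rooted_tree p (A \<union> B) (a + b)"
  using assms
proof (induction rule: rooted_tree.induct)
  case (point p)
  then show ?case using rooted_tree.join rooted_tree.point by blast
next
  case (join p A a A' a')
  show ?case
  proof (cases "q \<in> A")
    case True
    have "rooted_tree p ((A \<union> B) \<union> A') ((a + b) + a')"
      by (rule rooted_tree.join) (use join True in auto)
    then show ?thesis by (simp add: ac_simps)
  next
    case False
    have "rooted_tree p (A \<union> (A' \<union> B)) (a + (a' + b))"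
      by (rule rooted_tree.join) (use join False in auto)
    then show ?thesis by (simp add: ac_simps)
  qed
next
  case (stem g t A a)
  show ?case
  proof (cases "q \<in> A")
    case True
    have "rooted_tree (g 0) (g ` {0..t} \<union> (A \<union> B)) (t + (a + b))"
      by (rule rooted_tree.stem) (use stem True in auto)
    then show ?thesis by (simp add: ac_simps)
  next
    case False
    then obtain u where u: "u \<in> {0..t}" "q = g u" using stem.prems by auto
    have "rooted_tree (g (u + 0)) ((\<lambda>w. g (u + w)) ` {0..t - u} \<union> A) (t - u + a)"
      by (rule rooted_tree.stem) (use stem.hyps segment_final[OF _ u(1)] in auto)
    moreover have "(\<lambda>w. g (u + w)) ` {0..t - u} = g ` {u..t}"
      using image_image[of g "(+) u" "{0..t - u}"] by simp
    ultimately have "rooted_tree (g u) ((g ` {u..t} \<union> A) \<union> B) (t - u + a + b)"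
      using stem.prems u by (auto intro: rooted_tree.join)
    then have "rooted_tree (g 0) (g ` {0..u} \<union> ((g ` {u..t} \<union> A) \<union> B)) (u + (t - u + a + b))"
      using segment_initial[OF stem.hyps(1) u(1)] by (rule rooted_tree.stem[rotated])
    moreover have "{0..t} = {0..u} \<union> {u..t}" using u by auto
    then have "g ` {0..u} \<union> ((g ` {u..t} \<union> A) \<union> B) = g ` {0..t} \<union> A \<union> B" by (auto simp: image_Un)
    ultimately show ?thesis by (simp add: algebra_simps)
  qed
qed

text \<open>A tree is connected, so its diameter is at most its length.\<close>

lemma dist_le_length:
  assumes "rooted_tree p A a" "x \<in> A" "y \<in> A"
  shows "dist_le x y a"
  using assms
proof (induction arbitrary: x y rule: rooted_tree.induct)
  case (point p)
  then show ?case using dist_le_refl by auto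
next
  case (join p A a B b)
  have p: "p \<in> A" "p \<in> B" and nonneg: "0 \<le> a" "0 \<le> b"
    using join.hyps rooted_tree_basics by auto
  have "dist_le x y (a + b)" if "x \<in> A" "y \<in> B" for x y
    by (rule dist_le_trans[OF join.IH(1)[OF that(1) p(1)] join.IH(2)[OF p(2) that(2)]])
  moreover have "dist_le x y (a + b)" if "x \<in> A" "y \<in> A" for x y
    by (rule dist_le_mono[of x y a]) (use that join.IH(1) nonneg in auto)
  moreover have "dist_le x y (a + b)" if "x \<in> B" "y \<in> B" for x y
    by (rule dist_le_mono[of x y b]) (use that join.IH(2) nonneg in auto)
  ultimately show ?case using join.prems dist_le_sym[of y x "a + b"] by auto
next
  case (stem g t A a)
  have p: "g t \<in> A" and nonneg: "0 \<le> a" "0 \<le> t" and tt: "t \<in> {0..t}"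
    using stem.hyps rooted_tree_basics by (auto simp: segment_def)
  have seg: "dist_le x y t" if xy: "x \<in> g ` {0..t}" "y \<in> g ` {0..t}" for x y
  proof -
    obtain u v where uv: "u \<in> {0..t}" "v \<in> {0..t}" "x = g u" "y = g v" using xy by auto
    then have "dist_le x y \<bar>u - v\<bar>" using segmentD[OF stem.hyps(1)] by simp
    then show ?thesis using uv by (elim dist_le_mono) auto
  qed
  have "dist_le x y (t + a)" if "x \<in> g ` {0..t}" "y \<in> A" for x y
    by (rule dist_le_trans[OF seg[OF that(1) imageI[OF tt]] stem.IH[OF p that(2)]])
  moreover have "dist_le x y (t + a)" if "x \<in> g ` {0..t}" "y \<in> g ` {0..t}" for x y
    by (rule dist_le_mono[of x y t]) (use that seg nonneg in auto)
  moreover have "dist_le x y (t + a)" if "x \<in> A" "y \<in> A" for x y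
    by (rule dist_le_mono[of x y a]) (use that stem.IH nonneg in auto)
  ultimately show ?case using stem.prems dist_le_sym[of y x "t + a"] by blast
qed

text \<open>The greedy step. Either the whole tree is within distance \<open>r\<close> of the root, or there is a
  point \<open>v\<close> such that the part of the tree beyond \<open>v\<close> has height \<open>r\<close>, and one cuts there. The bound \<open>h\<close> on the
  height is kept at most the length \<open>a\<close>, so that once a stem leading to this tree is long enough
  for a cut, the part cut off, of height \<open>r\<close>, has length at least \<open>r\<close>. That \<open>v\<close> survives the cut
  serves \<open>covered_by_one_ball\<close>.\<close>

lemma prune:
  assumes "rooted_tree p A a" "0 \<le> r"
  shows "(\<exists>h. 0 \<le> h \<and> h \<le> r \<and> h \<le> a \<and> (\<forall>x\<in>A. dist_le x p h)) \<or>
    (\<exists>v A' a'. rooted_tree p A' a' \<and> v \<in> A' \<and> a' + r \<le> a \<and> (\<forall>x\<in>A - A'. dist_le x v r))"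
    (is "?low p A a \<or> ?cut p A a")
  using assms
proof (induction rule: rooted_tree.induct)
  case (point p)
  then show ?case using dist_le_refl by auto
next
  case (join p A a B b)
  have nonneg: "0 \<le> a" "0 \<le> b" using join.hyps rooted_tree_basics by auto
  consider "?cut p A a" | "?cut p B b" | "?low p A a" "?low p B b"
    using join by blast
  then show ?case
  proof cases
    case 1
    then obtain v A' a' where c: "rooted_tree p A' a'" "v \<in> A'" "a' + r \<le> a"
      "\<forall>x\<in>A - A'. dist_le x v r" by blast
    have "?cut p (A \<union> B) (a + b)"
      by (rule exI[of _ v], rule exI[of _ "A' \<union> B"], rule exI[of _ "a' + b"])
        (use c join.hyps(2) rooted_tree.join in auto)
    then show ?thesis ..
  next
    case 2
    then obtain v B' b' where c: "rooted_tree p B' b'" "v \<in> B'" "b' + r \<le> b"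
      "\<forall>x\<in>B - B'. dist_le x v r" by blast
    have "?cut p (A \<union> B) (a + b)"
      by (rule exI[of _ v], rule exI[of _ "A \<union> B'"], rule exI[of _ "a + b'"])
        (use c join.hyps(1) rooted_tree.join in auto)
    then show ?thesis ..
  next
    case 3
    obtain h where h: "0 \<le> h" "h \<le> r" "h \<le> a" "\<forall>x\<in>A. dist_le x p h"
      using 3(1) by blast
    obtain k where k: "0 \<le> k" "k \<le> r" "k \<le> b" "\<forall>x\<in>B. dist_le x p k"
      using 3(2) by blast
    note hk = h k
    have "?low p (A \<union> B) (a + b)"
    proof (intro exI[of _ "max h k"] conjI ballI)
      fix x assume "x \<in> A \<union> B"
      then show "dist_le x p (max h k)"
        using dist_le_mono[of x p h "max h k"] dist_le_mono[of x p k "max h k"] h(4) k(4) by auto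
    qed (use hk nonneg in auto)
    then show ?thesis ..
  qed
next
  case (stem g t A a)
  have nonneg: "0 \<le> a" "0 \<le> t" using stem.hyps rooted_tree_basics by (auto simp: segment_def)
  consider "?cut (g t) A a" | "?low (g t) A a" using stem by blast
  then show ?case
  proof cases
    case 1
    then obtain v A' a' where c: "rooted_tree (g t) A' a'" "v \<in> A'" "a' + r \<le> a"
      "\<forall>x\<in>A - A'. dist_le x v r" by blast
    have "?cut (g 0) (g ` {0..t} \<union> A) (t + a)"
      by (rule exI[of _ v], rule exI[of _ "g ` {0..t} \<union> A'"], rule exI[of _ "t + a'"])
        (use c stem.hyps(1) rooted_tree.stem in auto)
    then show ?thesis ..
  next
    case 2
    then obtain h where h: "0 \<le> h" "h \<le> r" "h \<le> a" "\<forall>x\<in>A. dist_le x (g t) h" by blast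
    have near: "dist_le x (g u) (t - u + h)" if u: "u \<in> {0..t}" and x: "x \<in> g ` {u..t} \<union> A" for x u
      using x
    proof
      assume "x \<in> g ` {u..t}"
      then obtain w where w: "w \<in> {u..t}" "x = g w" by auto
      then have "dist_le x (g u) \<bar>w - u\<bar>" using segmentD[OF stem.hyps(1), of w u] u by auto
      then show ?thesis using w h u by (elim dist_le_mono) auto
    next
      assume "x \<in> A"
      then have "dist_le x (g t) h" using h by blast
      moreover have "dist_le (g t) (g u) \<bar>t - u\<bar>" using segmentD[OF stem.hyps(1), of t u] u by auto
      ultimately have "dist_le x (g u) (h + \<bar>t - u\<bar>)" by (rule dist_le_trans)
      then show ?thesis using u by (simp add: add.commute)
    qed
    show ?thesis
    proof (cases "t + h \<le> r")
      case True
      have "?low (g 0) (g ` {0..t} \<union> A) (t + a)"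
      proof (intro exI[of _ "t + h"] conjI ballI)
        fix x assume "x \<in> g ` {0..t} \<union> A"
        then show "dist_le x (g 0) (t + h)" using near[of 0 x] nonneg by auto
      qed (use True h nonneg in auto)
      then show ?thesis ..
    next
      case False
      \<comment> \<open>The height is at most \<open>h\<close> over the end \<open>g t\<close> of the stem, hence at most \<open>r\<close> over \<open>g u\<close>.\<close>
      define u where "u = t + h - r"
      have u: "u \<in> {0..t}" using False h unfolding u_def by auto
      have "?cut (g 0) (g ` {0..t} \<union> A) (t + a)"
      proof (intro exI[of _ "g u"] exI[of _ "g ` {0..u}"] exI[of _ u] conjI ballI)
        show "rooted_tree (g 0) (g ` {0..u}) u"
          using stem_only segment_initial stem.hyps(1) u by blast
        show "g u \<in> g ` {0..u}" "u + r \<le> t + a" using u h u_def by auto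
        fix x assume x: "x \<in> g ` {0..t} \<union> A - g ` {0..u}"
        have "{0..t} = {0..u} \<union> {u..t}" using u by auto
        then have "x \<in> g ` {u..t} \<union> A" using x by auto
        then show "dist_le x (g u) r" using near[OF u] u_def by simp
      qed
      then show ?thesis ..
    qed
  qed
qed

text \<open>After one pruning step the remaining part has length at most \<open>a - r \<le> r\<close> and contains the
  centre, hence is in the same ball.\<close>

lemma covered_by_one_ball:
  assumes tree: "rooted_tree p A a" and r: "0 \<le> r" "a \<le> 2 * r"
  shows "\<exists>v\<in>X. \<forall>x\<in>A. dist_le x v r"
  using prune[OF tree r(1)]
proof (elim disjE exE conjE)
  fix h assume "h \<le> r" "\<forall>x\<in>A. dist_le x p h"
  then show ?thesis using dist_le_mono[of _ p h r] rooted_tree_basics[OF tree] by blast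
next
  fix v A' a' assume c: "rooted_tree p A' a'" "v \<in> A'" "a' + r \<le> a" "\<forall>x\<in>A - A'. dist_le x v r"
  have "dist_le x v r" if "x \<in> A'" for x
    using dist_le_length[OF c(1) that c(2)] c(3) r by (elim dist_le_mono) auto
  then show ?thesis using c rooted_tree_basics[OF c(1)] by blast
qed

text \<open>All radii but the last are spent on pruning. The last one counts twice, because a single ball
  covers a tree of twice its radius in length.\<close>

lemma covered_by_balls:
  assumes "rooted_tree p A a" "rs \<noteq> []" "\<forall>r\<in>set rs. 0 \<le> r" "a \<le> sum_list rs + last rs"
  shows "\<exists>vs. length vs = length rs \<and> set vs \<subseteq> X \<and>
    (\<forall>x\<in>A. \<exists>i<length rs. dist_le x (vs ! i) (rs ! i))"
  using assms
proof (induction rs arbitrary: A a)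
  case (Cons r rs)
  show ?case
  proof (cases "rs = []")
    case True
    then obtain v where "v \<in> X" "\<forall>x\<in>A. dist_le x v r"
      using covered_by_one_ball[OF Cons.prems(1), of r] Cons.prems by auto
    then show ?thesis using True by (intro exI[of _ "[v]"]) auto
  next
    case False
    have "0 \<le> r" using Cons.prems by auto
    from prune[OF Cons.prems(1) this] show ?thesis
    proof (elim disjE exE conjE)
      \<comment> \<open>The first ball covers the tree, and the other centres are arbitrary.\<close>
      fix h assume h: "h \<le> r" "\<forall>x\<in>A. dist_le x p h"
      have "dist_le x p r" if "x \<in> A" for x
        using h that dist_le_mono[of x p h r] by blast
      then show ?thesis
        using rooted_tree_basics[OF Cons.prems(1)]
        by (intro exI[of _ "replicate (length (r # rs)) p"]) auto
    next
      fix v A' a'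
      assume c: "rooted_tree p A' a'" "v \<in> A'" "a' + r \<le> a" "\<forall>x\<in>A - A'. dist_le x v r"
      have "a' \<le> sum_list rs + last rs" using c(3) Cons.prems(4) False by simp
      then obtain vs where vs: "length vs = length rs" "set vs \<subseteq> X"
        "\<forall>x\<in>A'. \<exists>i<length rs. dist_le x (vs ! i) (rs ! i)"
        using Cons.IH[OF c(1) False] Cons.prems(3) by auto
      have "\<exists>i<length (r # rs). dist_le x ((v # vs) ! i) ((r # rs) ! i)" if x: "x \<in> A" for x
      proof (cases "x \<in> A'")
        case True
        then obtain i where "i < length rs" "dist_le x (vs ! i) (rs ! i)" using vs by blast
        then show ?thesis by (intro exI[of _ "Suc i"]) auto
      next
        case False
        then show ?thesis using c(4) x by (intro exI[of _ 0]) auto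
      qed
      then show ?thesis
        using vs rooted_tree_basics[OF c(1)] c(2) by (intro exI[of _ "v # vs"]) auto
    qed
  qed
qed simp

end

section \<open>Paths in the metric realization\<close>

definition path_within where
  "path_within T x y c \<longleftrightarrow> (\<exists>c'\<le>c. path_of_length T x y c')"

lemma path_of_length_trans:
  assumes "path_of_length T y z d" "path_of_length T x y c"
  shows "path_of_length T x z (c + d)"
  using assms
proof (induction rule: path_of_length.induct)
  case (extend y z d e r)
  then have "path_of_length T x r ((c + d) + segment_length T e z r)"
    by (intro path_of_length.extend) auto
  then show ?case by (simp add: add.assoc)
qed simp

lemma path_of_length_single:
  assumes "e \<in> edges T" "x \<in> closed_edge T e" "y \<in> closed_edge T e"
  shows "path_of_length T x y (segment_length T e x y)"
proof -
  have "x \<in> points T" using assms(2) by (simp add: closed_edge_def)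
  from path_of_length.extend[OF path_of_length.trivial[OF this] assms] show ?thesis by simp
qed

lemma path_of_length_sym: "path_of_length T x y c \<Longrightarrow> path_of_length T y x c"
proof (induction rule: path_of_length.induct)
  case (extend p q c e r)
  have "segment_length T e r q = segment_length T e q r"
    by (simp add: segment_length_def abs_minus_commute)
  then show ?case
    using path_of_length_trans[OF extend.IH path_of_length_single[of e T r q]] extend.hyps
    by (simp add: add.commute)
qed (rule path_of_length.trivial)

lemma path_of_length_nonneg:
  assumes "path_of_length T x y c" "\<forall>e\<in>edges T. 0 < len T e"
  shows "0 \<le> c"
  using assms
proof (induction rule: path_of_length.induct)
  case (extend p q c e r)
  then have "0 \<le> segment_length T e q r" unfolding segment_length_def
    by (intro divide_nonneg_nonneg mult_nonneg_nonneg sum_nonneg) auto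
  then show ?case using extend by auto
qed simp

lemma path_dist_le:
  assumes "path_within T x y c" "\<forall>e\<in>edges T. 0 < len T e"
  shows "path_dist T x y \<le> c"
proof -
  obtain c' where c': "c' \<le> c" "path_of_length T x y c'" using assms(1) by (auto simp: path_within_def)
  have "bdd_below {c. path_of_length T x y c}"
    using path_of_length_nonneg assms(2) by (intro bdd_belowI[of _ 0]) blast
  then have "path_dist T x y \<le> c'" unfolding path_dist_def using c' by (intro cInf_lower) auto
  then show ?thesis using c' by simp
qed

interpretation tree: upper_distance "points T" "path_within T" for T :: "'v weighted_graph"
proof
  show "path_within T x x 0" if "x \<in> points T" for x
    using that path_of_length.trivial unfolding path_within_def by blast
  show "path_within T y x c" if "path_within T x y c" for x y c
    using that path_of_length_sym unfolding path_within_def by blast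
  show "path_within T x z (c + d)" if "path_within T x y c" "path_within T y z d" for x y z c d
    using that path_of_length_trans add_mono unfolding path_within_def by metis
  show "path_within T x y d" if "path_within T x y c" "c \<le> d" for x y c d
    using that order_trans unfolding path_within_def by metis
qed

section \<open>A finite metric tree is a rooted tree\<close>

definition vertex_point :: "'v \<Rightarrow> 'v \<Rightarrow> real" where
  "vertex_point a = (\<lambda>v. if v = a then 1 else 0)"

lemma support_vertex_point: "{v. vertex_point a v \<noteq> 0} = {a}"
  by (auto simp: vertex_point_def)

lemma vertex_point_in_points:
  "finite (verts T) \<Longrightarrow> a \<in> verts T \<Longrightarrow> vertex_point a \<in> points T"
  by (simp add: points_def support_vertex_point) (simp add: vertex_point_def)

text \<open>The point of the edge \<open>{a, b}\<close> of length \<open>l\<close> at distance \<open>u\<close> from \<open>a\<close>.\<close>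

definition edge_point :: "'v \<Rightarrow> 'v \<Rightarrow> real \<Rightarrow> real \<Rightarrow> 'v \<Rightarrow> real" where
  "edge_point a b l u = (\<lambda>v. if v = a then 1 - u / l else if v = b then u / l else 0)"

lemma edge_point_0: "edge_point a b l 0 = vertex_point a"
  by (auto simp: edge_point_def vertex_point_def)

lemma edge_point_end: "a \<noteq> b \<Longrightarrow> l \<noteq> 0 \<Longrightarrow> edge_point a b l l = vertex_point b"
  by (auto simp: edge_point_def vertex_point_def)

lemma edge_point_in_closed_edge:
  assumes fin: "finite (verts T)" and e: "{a, b} \<in> edges T" "{a, b} \<subseteq> verts T" "a \<noteq> b"
    and u: "0 < l" "u \<in> {0..l}"
  shows "edge_point a b l u \<in> closed_edge T {a, b}"
proof -
  consider "u = 0" | "u = l" | "0 < u" "u < l" using u by fastforce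
  then have "edge_point a b l u \<in> points T"
  proof cases
    case 3
    have "sum (edge_point a b l u) (verts T) = sum (edge_point a b l u) {a, b}"
      using fin e by (intro sum.mono_neutral_right) (auto simp: edge_point_def)
    also have "\<dots> = 1" using e by (simp add: edge_point_def)
    finally have "sum (edge_point a b l u) (verts T) = 1" .
    moreover have "{v. edge_point a b l u v \<noteq> 0} = {a, b}"
      using 3 e by (auto simp: edge_point_def)
    moreover have "\<forall>v. 0 \<le> edge_point a b l u v" using 3 by (auto simp: edge_point_def)
    ultimately show ?thesis using e by (simp add: points_def)
  qed (use u e fin in \<open>auto simp: edge_point_0 edge_point_end vertex_point_in_points\<close>)
  moreover have "{v. edge_point a b l u v \<noteq> 0} \<subseteq> {a, b}" by (auto simp: edge_point_def)
  ultimately show ?thesis by (simp add: closed_edge_def)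
qed

lemma segment_edge_point:
  assumes fin: "finite (verts T)" and e: "{a, b} \<in> edges T" "{a, b} \<subseteq> verts T" "a \<noteq> b"
    and l: "0 < len T {a, b}"
  shows "tree.segment T (edge_point a b (len T {a, b})) (len T {a, b})"
  unfolding tree.segment_def
proof (intro conjI ballI)
  let ?l = "len T {a, b}"
  let ?g = "edge_point a b ?l"
  have g: "?g u \<in> closed_edge T {a, b}" if "u \<in> {0..?l}" for u
    using that by (rule edge_point_in_closed_edge[OF fin e l])
  show "0 \<le> ?l" using l by simp
  show "?g ` {0..?l} \<subseteq> points T" using g by (auto simp: closed_edge_def)
  fix u v assume uv: "u \<in> {0..?l}" "v \<in> {0..?l}"
  have "\<bar>?g u a - ?g v a\<bar> = \<bar>u - v\<bar> / ?l" "\<bar>?g u b - ?g v b\<bar> = \<bar>u - v\<bar> / ?l"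
    using e(3) l by (auto simp: edge_point_def abs_divide simp flip: diff_divide_distrib)
  then have "segment_length T {a, b} (?g u) (?g v) = \<bar>u - v\<bar>"
    using e(3) l by (simp add: segment_length_def)
  then show "path_within T (?g u) (?g v) \<bar>u - v\<bar>"
    using path_of_length_single[OF e(1) g[OF uv(1)] g[OF uv(2)]] by (auto simp: path_within_def)
qed

lemma closed_edge_subset:
  assumes fin: "finite (verts T)" and e: "{a, b} \<subseteq> verts T" "a \<noteq> b" and l: "0 < l"
  shows "closed_edge T {a, b} \<subseteq> edge_point a b l ` {0..l}"
proof
  fix p assume "p \<in> closed_edge T {a, b}"
  then have p: "\<forall>v. 0 \<le> p v" "sum p (verts T) = 1" "{v. p v \<noteq> 0} \<subseteq> {a, b}"
    by (auto simp: closed_edge_def points_def)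
  have "sum p (verts T) = sum p {a, b}"
    using fin e p(3) by (intro sum.mono_neutral_right) auto
  then have ab: "p a + p b = 1" using p(2) e(2) by simp
  have "p = edge_point a b l (l * p b)"
  proof
    fix v show "p v = edge_point a b l (l * p b) v"
      using ab p(3) l by (auto simp: edge_point_def)
  qed
  moreover have "p b \<le> 1" using ab p(1)[rule_format, of a] by linarith
  then have "l * p b \<in> {0..l}" using p(1) l by (simp add: mult_left_le)
  ultimately show "p \<in> edge_point a b l ` {0..l}" by blast
qed

text \<open>Paths are lists without repetition, so that a path and a common outside neighbour of its ends can
  be turned into a \<open>graph_cycle\<close> directly.\<close>

definition linked_by_paths :: "('v, 'z) weighted_graph_scheme \<Rightarrow> 'v set \<Rightarrow> bool" where
  "linked_by_paths T S \<longleftrightarrow> (\<forall>x\<in>S. \<forall>y\<in>S. \<exists>w. w \<noteq> [] \<and> hd w = x \<and> last w = y \<and>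
     distinct w \<and> set w \<subseteq> S \<and> successively (\<lambda>u v. {u, v} \<in> edges T) w)"

lemma linked_by_paths_insert:
  assumes linked: "linked_by_paths T S" and ab: "a \<in> S" "b \<notin> S" "{a, b} \<in> edges T"
  shows "linked_by_paths T (insert b S)"
  unfolding linked_by_paths_def
proof (intro ballI)
  let ?path = "\<lambda>x y w. w \<noteq> [] \<and> hd w = x \<and> last w = y \<and>
     distinct w \<and> set w \<subseteq> insert b S \<and> successively (\<lambda>u v. {u, v} \<in> edges T) w"
  have to_b: "\<exists>w. ?path x b w" if x: "x \<in> S" for x
  proof -
    obtain w where "w \<noteq> []" "hd w = x" "last w = a" "distinct w" "set w \<subseteq> S"
      "successively (\<lambda>u v. {u, v} \<in> edges T) w"
      using linked x ab(1) unfolding linked_by_paths_def by blast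
    then show ?thesis using ab
      by (intro exI[of _ "w @ [b]"]) (auto simp: successively_append_iff)
  qed
  have "\<exists>w. ?path b x w" if x: "x \<in> S" for x
  proof -
    obtain w where "?path x b w" using to_b[OF x] by blast
    then show ?thesis
      by (intro exI[of _ "rev w"])
        (auto simp: hd_rev last_rev successively_rev insert_commute)
  qed
  moreover have "?path b b [b]" by simp
  moreover have "\<exists>w. ?path x y w" if "x \<in> S" "y \<in> S" for x y
    using linked that unfolding linked_by_paths_def by blast
  moreover fix x y assume "x \<in> insert b S" "y \<in> insert b S"
  ultimately show "\<exists>w. ?path x y w" using to_b by (metis insert_iff)
qed

text \<open>Two edges from \<open>b\<close> into \<open>S\<close> would close a path inside \<open>S\<close> to a cycle through \<open>b\<close>.\<close>

lemma unique_attaching_edge: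
  assumes linked: "linked_by_paths T S" and acyclic: "\<nexists>c. graph_cycle T c"
    and a: "a \<in> S" "{a, b} \<in> edges T" and x: "x \<in> S" "{x, b} \<in> edges T" and b: "b \<notin> S"
  shows "x = a"
proof (rule ccontr)
  assume "x \<noteq> a"
  obtain w where w: "w \<noteq> []" "hd w = a" "last w = x" "distinct w" "set w \<subseteq> S"
    "successively (\<lambda>u v. {u, v} \<in> edges T) w"
    using linked a(1) x(1) unfolding linked_by_paths_def by blast
  let ?c = "w @ [b]"
  have c: "successively (\<lambda>u v. {u, v} \<in> edges T) ?c" using w x by (auto simp: successively_append_iff)
  have "length w \<noteq> 1" using w(2,3) \<open>x \<noteq> a\<close> by (cases w) auto
  then have len: "2 \<le> length w" using w(1) by (cases w) (auto simp: Suc_le_eq)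
  have "graph_cycle T ?c" unfolding graph_cycle_def
  proof (intro conjI allI impI)
    fix i assume i: "i < length ?c"
    show "{?c ! i, ?c ! (Suc i mod length ?c)} \<in> edges T"
    proof (cases "Suc i < length ?c")
      case True
      then show ?thesis using c by (simp only: successively_conv_nth mod_less)
    next
      case False
      then have "i = length w" using i by simp
      then show ?thesis using w(1,2) a(2) by (simp add: nth_append hd_conv_nth insert_commute)
    qed
  qed (use w b len in auto)
  then show False using acyclic by blast
qed

text \<open>The induced subgraph on \<open>S\<close> is realized inside a rooted tree whose length is the total length
  of its edges. The vertex points are required separately, since a single
  vertex lies on no edge of the subgraph.\<close>

definition spanned where
  "spanned T S \<longleftrightarrow> S \<subseteq> verts T \<and> S \<noteq> {} \<and> linked_by_paths T S \<and>
     (\<exists>p A. tree.rooted_tree T p A (\<Sum>e\<in>{e \<in> edges T. e \<subseteq> S}. len T e) \<and>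
        vertex_point ` S \<subseteq> A \<and> (\<forall>e\<in>edges T. e \<subseteq> S \<longrightarrow> closed_edge T e \<subseteq> A))"

text \<open>The only new edge is \<open>{a, b}\<close>, which is grafted at \<open>a\<close>.\<close>

lemma spanned_insert:
  assumes tree: "finite_metric_tree T" and S: "spanned T S"
    and ab: "a \<in> S" "b \<notin> S" "{a, b} \<in> edges T"
  shows "spanned T (insert b S)"
proof -
  have graph: "finite (verts T)" "\<forall>e\<in>edges T. e \<subseteq> verts T \<and> card e = 2"
    and acyclic: "\<nexists>c. graph_cycle T c" and pos: "\<forall>e\<in>edges T. 0 < len T e"
    using tree by (auto simp: finite_metric_tree_def finite_simple_graph_def)
  have fin_edges: "finite (edges T)"
    using graph by (intro finite_subset[of "edges T" "Pow (verts T)"]) auto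
  have linked: "linked_by_paths T S" and SV: "S \<subseteq> verts T" using S by (auto simp: spanned_def)
  obtain p A where A: "tree.rooted_tree T p A (\<Sum>e\<in>{e \<in> edges T. e \<subseteq> S}. len T e)"
    "vertex_point ` S \<subseteq> A" "\<forall>e\<in>edges T. e \<subseteq> S \<longrightarrow> closed_edge T e \<subseteq> A"
    using S unfolding spanned_def by blast
  have abV: "{a, b} \<subseteq> verts T" and "a \<noteq> b" using graph(2) ab by auto
  let ?l = "len T {a, b}"
  let ?g = "edge_point a b ?l"
  have l: "0 < ?l" using pos ab by blast
  have "tree.rooted_tree T (vertex_point a) (?g ` {0..?l}) ?l"
    using tree.stem_only[OF segment_edge_point[OF graph(1) ab(3) abV \<open>a \<noteq> b\<close> l]]
    by (simp add: edge_point_0)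
  then have grafted: "tree.rooted_tree T p (A \<union> ?g ` {0..?l})
      ((\<Sum>e\<in>{e \<in> edges T. e \<subseteq> S}. len T e) + ?l)"
    using A(2) ab(1) by (intro tree.graft[OF A(1)]) auto
  have new_edge: "e \<subseteq> S \<or> e = {a, b}" if e: "e \<in> edges T" "e \<subseteq> insert b S" for e
  proof (cases "b \<in> e")
    case True
    then obtain x where x: "e = {x, b}" "x \<noteq> b"
      using graph(2) e(1) by (metis card_2_iff doubleton_eq_iff insertE singletonD)
    then have "x = a"
      using e unique_attaching_edge[OF linked acyclic ab(1,3) _ _ ab(2), of x] by auto
    then show ?thesis using x by simp
  qed (use e in blast)
  have "{e \<in> edges T. e \<subseteq> insert b S} = insert {a, b} {e \<in> edges T. e \<subseteq> S}"
    using new_edge ab by auto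
  then have "(\<Sum>e\<in>{e \<in> edges T. e \<subseteq> insert b S}. len T e) =
      (\<Sum>e\<in>{e \<in> edges T. e \<subseteq> S}. len T e) + ?l"
    using fin_edges ab(2) by (simp add: add.commute)
  with grafted have "tree.rooted_tree T p (A \<union> ?g ` {0..?l})
      (\<Sum>e\<in>{e \<in> edges T. e \<subseteq> insert b S}. len T e)" by simp
  moreover have "vertex_point ` insert b S \<subseteq> A \<union> ?g ` {0..?l}"
  proof -
    have "?g ?l = vertex_point b" by (rule edge_point_end) (use \<open>a \<noteq> b\<close> l in auto)
    then have "vertex_point b \<in> ?g ` {0..?l}" using l by (intro image_eqI[of _ _ ?l]) auto
    then show ?thesis using A(2) by blast
  qed
  moreover have "\<forall>e\<in>edges T. e \<subseteq> insert b S \<longrightarrow> closed_edge T e \<subseteq> A \<union> ?g ` {0..?l}"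
  proof (intro ballI impI)
    fix e assume e: "e \<in> edges T" "e \<subseteq> insert b S"
    from new_edge[OF this] show "closed_edge T e \<subseteq> A \<union> ?g ` {0..?l}"
    proof
      assume "e \<subseteq> S"
      then show ?thesis using A(3) e(1) by blast
    next
      assume "e = {a, b}"
      then show ?thesis
        using closed_edge_subset[OF graph(1) abV \<open>a \<noteq> b\<close> l] by (simp add: le_supI2)
    qed
  qed
  moreover have "insert b S \<subseteq> verts T" using SV abV by simp
  ultimately show ?thesis
    using linked_by_paths_insert[OF linked ab] unfolding spanned_def
    by (intro conjI exI[of _ p] exI[of _ "A \<union> ?g ` {0..?l}"]) simp_all
qed

lemma spanned_singleton:
  assumes tree: "finite_metric_tree T" and v: "v \<in> verts T"
  shows "spanned T {v}"
proof -
  have graph: "finite (verts T)" "\<forall>e\<in>edges T. card e = 2"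
    using tree by (auto simp: finite_metric_tree_def finite_simple_graph_def)
  have no_edge: "\<not> e \<subseteq> {v}" if "e \<in> edges T" for e
    using graph(2) that card_mono[of "{v}" e] by fastforce
  then have no_edges: "{e \<in> edges T. e \<subseteq> {v}} = {}" by blast
  have "tree.rooted_tree T (vertex_point v) {vertex_point v} 0"
    using vertex_point_in_points[OF graph(1) v] by (rule tree.point)
  moreover have "linked_by_paths T {v}"
    unfolding linked_by_paths_def by (auto intro!: exI[of _ "[v]"])
  ultimately show ?thesis using v no_edge
    unfolding spanned_def no_edges by (fastforce)
qed

text \<open>A largest spanned set is the whole vertex set: otherwise, by connectedness, an edge leaves it,
  and the set can be enlarged.\<close>

lemma spanned_verts:
  assumes tree: "finite_metric_tree T"
  shows "spanned T (verts T)"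
proof -
  have fin: "finite (verts T)" and connected: "connected_graph T"
    using tree by (auto simp: finite_metric_tree_def finite_simple_graph_def)
  obtain v where v: "v \<in> verts T" using connected by (auto simp: connected_graph_def)
  have bound: "card S \<le> card (verts T)" if "spanned T S" for S
    using that fin card_mono by (auto simp: spanned_def)
  obtain S where S: "spanned T S" "\<And>S'. spanned T S' \<Longrightarrow> card S' \<le> card S"
    using ex_has_greatest_nat[of "spanned T" "{v}" card "Suc (card (verts T))"]
      spanned_singleton[OF tree v] bound by (auto simp: less_Suc_eq_le)
  have finS: "finite S" using S(1) fin finite_subset by (auto simp: spanned_def)
  obtain x where x: "x \<in> S" "x \<in> verts T" using S(1) by (auto simp: spanned_def)
  have "y \<in> S" if y: "y \<in> verts T" for y
  proof -
    have "(x, y) \<in> {(x, y). {x, y} \<in> edges T}\<^sup>*"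
      using connected x y by (auto simp: connected_graph_def)
    then show ?thesis
    proof (induction rule: rtrancl_induct)
      case (step y z)
      show ?case
      proof (rule ccontr)
        assume z: "z \<notin> S"
        then have "card (insert z S) \<le> card S"
          using S(2) spanned_insert[OF tree S(1)] step by auto
        then show False using finS z by simp
      qed
    qed (rule x(1))
  qed
  then have "S = verts T" using S(1) by (auto simp: spanned_def)
  then show ?thesis using S(1) by simp
qed

lemma finite_metric_tree_imp_rooted_tree:
  assumes tree: "finite_metric_tree T"
  shows "\<exists>p. tree.rooted_tree T p (points T) (total_length T)"
proof -
  have edge: "\<forall>e\<in>edges T. e \<subseteq> verts T"
    using tree by (auto simp: finite_metric_tree_def finite_simple_graph_def)
  have all_edges: "{e \<in> edges T. e \<subseteq> verts T} = edges T" using edge by blast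
  obtain p A where A: "tree.rooted_tree T p A (total_length T)"
    "vertex_point ` verts T \<subseteq> A" "\<forall>e\<in>edges T. e \<subseteq> verts T \<longrightarrow> closed_edge T e \<subseteq> A"
    using spanned_verts[OF tree] unfolding spanned_def total_length_def all_edges by (elim conjE exE)
  have "points T \<subseteq> A"
  proof
    fix q assume q: "q \<in> points T"
    then consider v where "v \<in> verts T" "{v. q v \<noteq> 0} = {v}" | "{v. q v \<noteq> 0} \<in> edges T"
      by (auto simp: points_def)
    then show "q \<in> A"
    proof cases
      case (1 v)
      have fin: "finite (verts T)"
        using tree by (auto simp: finite_metric_tree_def finite_simple_graph_def)
      have "sum q (verts T) = sum q {v}"
        using fin 1 by (intro sum.mono_neutral_right) auto
      then have "q v = 1" using q by (simp add: points_def)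
      then have "q = vertex_point v" using 1(2) by (auto simp: vertex_point_def fun_eq_iff)
      then show ?thesis using A(2) 1(1) by blast
    next
      case 2
      then have "q \<in> closed_edge T {v. q v \<noteq> 0}" using q by (simp add: closed_edge_def)
      then show ?thesis using A(3) 2 edge by blast
    qed
  qed
  moreover have "A \<subseteq> points T" using tree.rooted_tree_basics[OF A(1)] by blast
  ultimately show ?thesis using A(1) by auto
qed

section \<open>Choosing the subtuple\<close>

lemma in_covers_if_long:
  fixes T :: "'v weighted_graph"
  assumes tree: "finite_metric_tree T" and rs: "rs \<noteq> []" "\<forall>r\<in>set rs. 0 \<le> r"
    and long: "total_length T \<le> sum_list rs + last rs"
  shows "rs \<in> covers T"
proof -
  have pos: "\<forall>e\<in>edges T. 0 < len T e" using tree by (simp add: finite_metric_tree_def)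
  obtain p where "tree.rooted_tree T p (points T) (total_length T)"
    using finite_metric_tree_imp_rooted_tree[OF tree] by blast
  from tree.covered_by_balls[OF this rs long]
  obtain vs where vs: "length vs = length rs" "set vs \<subseteq> points T"
    "\<forall>x\<in>points T. \<exists>i<length rs. path_within T x (vs ! i) (rs ! i)" by blast
  then have "points T \<subseteq> (\<Union>i<length rs. tree_ball T (vs ! i) (rs ! i))"
    using path_dist_le[OF _ pos] unfolding tree_ball_def by fast
  then show ?thesis using vs rs unfolding covers_def by blast
qed

text \<open>The prefix ends just before the partial sums exceed \<open>L\<close>. The entry that follows it is at most the
  last entry of the prefix, which gives the lower bound.\<close>

lemma descending_prefix:
  fixes xs :: "real list"
  assumes desc: "sorted_wrt (\<ge>) xs" and bounded: "\<forall>x\<in>set xs. x \<le> L" and big: "L < sum_list xs"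
    and L: "0 \<le> L"
  shows "\<exists>n. take n xs \<noteq> [] \<and> sum_list (take n xs) \<le> L \<and>
    L \<le> sum_list (take n xs) + last (take n xs)"
proof -
  define k where "k = (LEAST k. L < sum_list (take k xs))"
  have k: "L < sum_list (take k xs)"
    unfolding k_def by (rule LeastI[of _ "length xs"]) (use big in simp)
  have before: "sum_list (take j xs) \<le> L" if "j < k" for j
    using that not_less_Least unfolding k_def by fastforce
  obtain n where n: "k = Suc n" using k L by (cases k) auto
  have nlen: "n < length xs"
  proof (rule ccontr)
    assume "\<not> n < length xs"
    then show False using before[of n] big n by simp
  qed
  have step: "sum_list (take k xs) = sum_list (take n xs) + xs ! n"
    using n nlen by (simp add: take_Suc_conv_app_nth)
  have "n \<noteq> 0"
  proof
    assume "n = 0"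
    then have "L < xs ! 0" using k step by simp
    moreover have "xs ! 0 \<in> set xs" using nlen by (intro nth_mem) auto
    then have "xs ! 0 \<le> L" using bounded by blast
    ultimately show False by simp
  qed
  then have nonempty: "take n xs \<noteq> []" using nlen by auto
  then have last: "last (take n xs) = xs ! (n - 1)" using nlen by (simp add: last_conv_nth)
  have "xs ! n \<le> xs ! (n - 1)"
    using sorted_wrt_nth_less[OF desc, of "n - 1" n] nlen \<open>n \<noteq> 0\<close> by simp
  then show ?thesis using before[of n] n k step last nonempty by (intro exI[of _ n]) auto
qed

theorem lemma2p11:
  fixes T :: "'v weighted_graph" and L :: real and s :: "real list"
  assumes "finite_metric_tree T"
    and "L = total_length T"
    and "L > 0"
    and "s \<in> covers T"
    and "\<forall>i<length s. 0 \<le> s ! i \<and> s ! i \<le> L"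
  shows "\<exists>s' r. mset s' = mset s \<and> subseq r s' \<and> r \<in> covers0 T"
proof (cases "sum_list s \<le> L")
  case True
  then show ?thesis using assms(2,4) unfolding covers0_def by blast
next
  case False
  let ?s' = "rev (sort s)"
  have s: "\<forall>x\<in>set s. 0 \<le> x \<and> x \<le> L" using assms(5) by (auto simp: in_set_conv_nth)
  have mset: "mset ?s' = mset s" by simp
  have "sum_list ?s' = sum_list s" by (metis mset sum_mset_sum_list)
  moreover have "sorted_wrt (\<ge>) ?s'" by (simp add: sorted_wrt_rev)
  ultimately obtain n where n: "take n ?s' \<noteq> []" "sum_list (take n ?s') \<le> L"
    "L \<le> sum_list (take n ?s') + last (take n ?s')"
    using descending_prefix[of ?s' L] False s assms(3) by auto
  have "\<forall>x\<in>set (take n ?s'). 0 \<le> x" using s by (auto dest: in_set_takeD)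
  then have "take n ?s' \<in> covers T"
    using in_covers_if_long[OF assms(1) n(1)] n(3) assms(2) by simp
  then have "take n ?s' \<in> covers0 T" using n(2) assms(2) by (simp add: covers0_def)
  moreover have "subseq (take n ?s') ?s'" by (intro prefix_imp_subseq take_is_prefix)
  ultimately show ?thesis using mset by blast
qed

end
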